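(* Let $K_n$ be the complete graph on $n$ vertices $v_1,\dots,v_n$, with $d_i$ the degree of $v_i$, and let $f$, $f(v_i)=k_i$, be an admissible function on $K_n$. If there are at most $\left\lfloor\frac{2n}{3}\right\rfloor$ vertices $v_i$ with $k_i=d_i$, then $\gamma_{\overline{f}}(K_n)\le\left\lceil\frac{n}{3}\right\rceil$.
   Context: All graphs $G=(V,E)$ are finite and simple, $V=\{v_1,\dots,v_n\}$, and $d_i=d_G(v_i)$ is the degree of $v_i$. An admissible function is a function $f:V\to\mathbb{N}$, written $f(v_i)=k_i$, such that $1\le k_i\le d_i$ for every non-isolated vertex $v_i$, and $k_i=1$ if $v_i$ is isolated. A set $D\subseteq V$ is a ceil degree restricted dominating set (CDRD-set) if each vertex of $V\setminus D$ can be assigned to a vertex of $D$ adjacent to it (which is said to dominate it) in such a way that each $v_i\in D$ has at most $\lceil d_i/k_i\rceil$ vertices of $V\setminus D$ assigned to it. The minimum cardinality of a CDRD-set of $G$ is denoted $\gamma_{\overline{f}}(G)$. *)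

theory Defs
  imports Complex_Main "Graph_Theory.Graph_Theory"
begin

text \<open>
  A finite simple graph is a \<^locale>\<open>graph\<close>: a finite symmetric digraph without loops and
  multiple arcs, an edge being a pair of opposite arcs.  The degree of a vertex is then its
  \<^const>\<open>out_degree\<close>, and \<open>u \<rightarrow>\<^bsub>G\<^esub> v\<close> is adjacency.
\<close>

lemma (in graph) out_degree_eq_card_neighbours:
  "out_degree G v = card {u \<in> verts G. v \<rightarrow>\<^bsub>G\<^esub> u}"
proof -
  have "head G ` out_arcs G v = {u \<in> verts G. v \<rightarrow>\<^bsub>G\<^esub> u}"
    by (auto simp: arcs_ends_conv)
  moreover have "inj_on (head G) (out_arcs G v)"
    by (rule inj_onI) (auto intro: no_multi_arcs simp: arc_to_ends_def)
  ultimately show ?thesis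
    unfolding out_degree_def by (metis card_image)
qed

text \<open>Values of \<open>f\<close> outside the vertex set are irrelevant.\<close>

definition admissible :: "('a, 'b) pre_digraph \<Rightarrow> ('a \<Rightarrow> nat) \<Rightarrow> bool" where
  "admissible G f \<longleftrightarrow>
     (\<forall>v \<in> verts G. if out_degree G v = 0 then f v = 1 else 1 \<le> f v \<and> f v \<le> out_degree G v)"

text \<open>The function \<open>a\<close> assigns to each vertex outside \<open>D\<close> the vertex of \<open>D\<close> dominating it.\<close>

definition cdrd_set :: "('a, 'b) pre_digraph \<Rightarrow> ('a \<Rightarrow> nat) \<Rightarrow> 'a set \<Rightarrow> bool" where
  "cdrd_set G f D \<longleftrightarrow> D \<subseteq> verts G \<and>
     (\<exists>a. (\<forall>u \<in> verts G - D. a u \<in> D \<and> a u \<rightarrow>\<^bsub>G\<^esub> u) \<and>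
          (\<forall>v \<in> D. int (card {u \<in> verts G - D. a u = v})
                      \<le> \<lceil>real (out_degree G v) / real (f v)\<rceil>))"

definition cdrd_number :: "('a, 'b) pre_digraph \<Rightarrow> ('a \<Rightarrow> nat) \<Rightarrow> nat" where
  "cdrd_number G f = (LEAST k. \<exists>D. cdrd_set G f D \<and> card D = k)"

text \<open>The minimum is over a nonempty set, since the whole vertex set is always a CDRD-set.\<close>

lemma cdrd_set_verts: "cdrd_set G f (verts G)"
proof -
  have "0 \<le> \<lceil>real (out_degree G v) / real (f v)\<rceil>" for v
    using ceiling_mono[of 0 "real (out_degree G v) / real (f v)"] by simp
  then show ?thesis
    unfolding cdrd_set_def by simp
qed

lemma cdrd_number_attained: "\<exists>D. cdrd_set G f D \<and> card D = cdrd_number G f"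
  unfolding cdrd_number_def by (rule LeastI_ex) (use cdrd_set_verts in blast)

lemma cdrd_number_le: "cdrd_set G f D \<Longrightarrow> cdrd_number G f \<le> card D"
  unfolding cdrd_number_def by (rule Least_le) blast

end

theory Submission
  imports Defs
begin

text \<open>
  A vertex of \<open>K\<^sub>n\<close> with \<open>k\<^sub>i < d\<^sub>i\<close> can dominate two vertices, and at least
  \<open>n - \<lfloor>2n/3\<rfloor> = \<lceil>n/3\<rceil>\<close> vertices are of this kind.  Any \<open>\<lceil>n/3\<rceil>\<close> of them can therefore
  dominate the remaining \<open>\<lfloor>2n/3\<rfloor>\<close> vertices.
\<close>

text \<open>Each element of \<open>D\<close> offers \<open>c\<close> slots, the pairs in
  \<open>D \<times> {..<c}\<close>. There are enough slots to place \<open>U\<close> injectively;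
  \<open>a\<close> forgets the slot number, so a fibre of \<open>a\<close> over \<open>v\<close>
  injects into the \<open>c\<close> slots of \<open>v\<close>.\<close>

lemma assignment_bounded_fibres:
  fixes U :: "'a set" and D :: "'b set"
  assumes "finite U" and "finite D" and "card U \<le> c * card D"
  obtains a where "\<And>u. u \<in> U \<Longrightarrow> a u \<in> D" and "\<And>v. card {u \<in> U. a u = v} \<le> c"
proof -
  have "card U \<le> card (D \<times> {..<c})"
    using assms(3) by (simp add: card_cartesian_product mult.commute)
  then obtain g where g: "g ` U \<subseteq> D \<times> {..<c}" "inj_on g U"
    using card_le_inj[of U "D \<times> {..<c}"] assms by blast
  show thesis
  proof (rule that)
    show "(fst \<circ> g) u \<in> D" if "u \<in> U" for u
      using g(1) that by fastforce
    show "card {u \<in> U. (fst \<circ> g) u = v} \<le> c" for v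
    proof -
      have "card {u \<in> U. (fst \<circ> g) u = v} \<le> card ({v} \<times> {..<c})"
      proof (rule card_inj_on_le)
        show "inj_on g {u \<in> U. (fst \<circ> g) u = v}"
          using g(2) by (rule inj_on_subset) auto
        show "g ` {u \<in> U. (fst \<circ> g) u = v} \<subseteq> {v} \<times> {..<c}"
          using g(1) by fastforce
      qed simp
      then show ?thesis by (simp add: card_cartesian_product)
    qed
  qed
qed

lemma out_degree_complete_digraph:
  assumes "complete_digraph n G" and "v \<in> verts G"
  shows "out_degree G v = n - 1"
proof -
  interpret graph G using assms(1) by (simp add: complete_digraph_def)
  have "{u \<in> verts G. v \<rightarrow>\<^bsub>G\<^esub> u} = verts G - {v}"
    using assms by (auto simp: complete_digraph_def)
  then show ?thesis
    using assms by (simp add: out_degree_eq_card_neighbours complete_digraph_def)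
qed

text \<open>The quotient strictly exceeds 1, and an integer above a number greater than 1 is at
  least 2. Positivity of \<open>k\<close> excludes division by zero, which would give 0.\<close>

lemma ceiling_divide_ge_2:
  assumes "1 \<le> k" and "k < d"
  shows "2 \<le> \<lceil>real d / real k\<rceil>"
  using assms by (simp add: le_ceiling_iff field_simps)

theorem theorem2p8:
  fixes G :: "('a, 'b) pre_digraph" and n :: nat and f :: "'a \<Rightarrow> nat"
  assumes "complete_digraph n G"
    and "admissible G f"
    and "int (card {v \<in> verts G. f v = out_degree G v}) \<le> \<lfloor>2 * real n / 3\<rfloor>"
  shows "int (cdrd_number G f) \<le> \<lceil>real n / 3\<rceil>"
proof (cases "n \<le> 1")
  \<comment> \<open>A single vertex is isolated, so it has \<open>f v = 1\<close> and degree 0: here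
    \<open>f v\<close> differs from the degree without being smaller. The whole vertex set is small
    enough instead, as \<open>n\<close> equals the ceiling of \<open>n / 3\<close> for
    \<open>n = 0\<close> and \<open>n = 1\<close>.\<close>
  case True
  have "cdrd_number G f \<le> n"
    using cdrd_number_le[OF cdrd_set_verts[of G f]] assms(1) by (simp add: complete_digraph_def)
  moreover have "int n \<le> \<lceil>real n / 3\<rceil>"
    using True by (auto simp: le_Suc_eq le_ceiling_iff)
  ultimately show ?thesis by linarith
next
  case False
  interpret graph G using assms(1) by (simp add: complete_digraph_def)
  have card_V: "card (verts G) = n" using assms(1) by (simp add: complete_digraph_def)
  have deg: "out_degree G v = n - 1" if "v \<in> verts G" for v
    using out_degree_complete_digraph[OF assms(1) that] .
  define m where "m = nat \<lceil>real n / 3\<rceil>"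
  have m: "int m = \<lceil>real n / 3\<rceil>" by (simp add: m_def)
  have n_le: "n \<le> 3 * m" using m by linarith
  let ?S = "{v \<in> verts G. f v = out_degree G v}"
  let ?B = "verts G - ?S"
  have "card ?B = n - card ?S"
    using card_V by (subst card_Diff_subset) auto
  then have "m \<le> card ?B" using assms(3) m by linarith
  then obtain D where D: "D \<subseteq> ?B" "card D = m" "finite D"
    by (rule obtain_subset_with_card_n)
  \<comment> \<open>The \<open>n - m\<close> vertices left over number at most \<open>2 * m\<close>,
    by \<open>n_le\<close>.\<close>
  have "card (verts G - D) \<le> 2 * card D"
    using D card_V n_le by (subst card_Diff_subset) auto
  then obtain a where a: "\<And>u. u \<in> verts G - D \<Longrightarrow> a u \<in> D"
      "\<And>v. card {u \<in> verts G - D. a u = v} \<le> 2"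
    using assignment_bounded_fibres[of "verts G - D" D 2] D(3) by auto
  have "cdrd_set G f D"
    unfolding cdrd_set_def
  proof (intro conjI exI ballI)
    show "D \<subseteq> verts G" using D(1) by auto
    show "a u \<in> D" if "u \<in> verts G - D" for u using a(1)[OF that] .
    show "a u \<rightarrow>\<^bsub>G\<^esub> u" if "u \<in> verts G - D" for u
    proof -
      have "a u \<in> verts G" "u \<in> verts G" "a u \<noteq> u" using a(1)[OF that] that D(1) by auto
      then show ?thesis using assms(1) by (auto simp: complete_digraph_def)
    qed
    show "int (card {u \<in> verts G - D. a u = v}) \<le> \<lceil>real (out_degree G v) / real (f v)\<rceil>"
      if "v \<in> D" for v
    proof -
      have v: "v \<in> verts G" "f v \<noteq> out_degree G v" using that D(1) by auto
      \<comment> \<open>Since \<open>n\<close> is at least 2, the degree \<open>n - 1\<close> is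
        positive, so admissibility bounds \<open>f v\<close> by the degree; membership in
        \<open>?B\<close> makes this bound strict.\<close>
      then have "1 \<le> f v" "f v < out_degree G v"
        using assms(2) False deg[OF v(1)] unfolding admissible_def
        by (auto split: if_splits dest!: bspec[OF _ v(1)])
      then have "2 \<le> \<lceil>real (out_degree G v) / real (f v)\<rceil>" by (rule ceiling_divide_ge_2)
      with a(2)[of v] show ?thesis by linarith
    qed
  qed
  then show ?thesis using cdrd_number_le D(2) m by fastforce
qed

end
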